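(* Let $(\Omega,\mathcal{B},\mu)$ be a $\sigma$-finite measure space with $\mu(\Omega)=\infty$, let $T:\Omega\to\Omega$ be a conservative, invertible, ergodic, measure-preserving transformation, let $f:\Omega\to\mathbb{R}$ be bounded and measurable, and for $\omega\in\Omega$ let $H_\omega$ be the bounded self-adjoint operator on $\ell^2(\mathbb{Z})$ given by $(H_\omega u)_n=u_{n-1}+u_{n+1}+f(T^n\omega)u_n$. Then there exists a compact set $\Sigma\subseteq\mathbb{R}$ such that $\sigma(H_\omega)=\Sigma$ for $\mu$-almost every $\omega\in\Omega$.
   Context: A measurable transformation $T$ is: invertible if it is bijective and $T^{-1}$ is measurable; measure-preserving if $\mu(T^{-1}E)=\mu(E)$ for all $E\in\mathcal{B}$; ergodic if $T^{-1}E=E$ (with $E\in\mathcal{B}$) implies $\mu(E)=0$ or $\mu(\Omega\setminus E)=0$; conservative if there is no $W\in\mathcal{B}$ with $\mu(W)>0$ such that the sets $T^{-n}W$, $n\ge 0$, are pairwise disjoint. $\sigma(H)$ denotes the spectrum of $H$. *)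

theory Defs
  imports "HOL-Analysis.Analysis"
begin

definition ell2 :: "(int \<Rightarrow> complex) set" where
  "ell2 = {u. (\<lambda>n. (cmod (u n))\<^sup>2) summable_on UNIV}"

definition ell2_norm :: "(int \<Rightarrow> complex) \<Rightarrow> real" where
  "ell2_norm u = sqrt (\<Sum>\<^sub>\<infinity>n. (cmod (u n))\<^sup>2)"

definition ell2_inner :: "(int \<Rightarrow> complex) \<Rightarrow> (int \<Rightarrow> complex) \<Rightarrow> complex" where
  "ell2_inner u v = (\<Sum>\<^sub>\<infinity>n. cnj (u n) * v n)"

text \<open>Operators are functions on all two-sided sequences; only their restriction to
  \<^const>\<open>ell2\<close> matters in the following notions.\<close>

definition ell2_bounded_op :: "((int \<Rightarrow> complex) \<Rightarrow> (int \<Rightarrow> complex)) \<Rightarrow> bool" where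
  "ell2_bounded_op A \<longleftrightarrow>
     (\<forall>u\<in>ell2. A u \<in> ell2) \<and>
     (\<forall>u\<in>ell2. \<forall>v\<in>ell2. A (\<lambda>n. u n + v n) = (\<lambda>n. A u n + A v n)) \<and>
     (\<forall>c. \<forall>u\<in>ell2. A (\<lambda>n. c * u n) = (\<lambda>n. c * A u n)) \<and>
     (\<exists>K. \<forall>u\<in>ell2. ell2_norm (A u) \<le> K * ell2_norm u)"

definition ell2_selfadjoint :: "((int \<Rightarrow> complex) \<Rightarrow> (int \<Rightarrow> complex)) \<Rightarrow> bool" where
  "ell2_selfadjoint A \<longleftrightarrow>
     ell2_bounded_op A \<and> (\<forall>u\<in>ell2. \<forall>v\<in>ell2. ell2_inner (A u) v = ell2_inner u (A v))"

definition ell2_invertible :: "((int \<Rightarrow> complex) \<Rightarrow> (int \<Rightarrow> complex)) \<Rightarrow> bool" where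
  "ell2_invertible A \<longleftrightarrow>
     (\<exists>B. ell2_bounded_op B \<and> (\<forall>u\<in>ell2. B (A u) = u) \<and> (\<forall>u\<in>ell2. A (B u) = u))"

definition ell2_spectrum :: "((int \<Rightarrow> complex) \<Rightarrow> (int \<Rightarrow> complex)) \<Rightarrow> complex set" where
  "ell2_spectrum A = {z. \<not> ell2_invertible (\<lambda>u n. A u n - z * u n)}"

definition invertible_map :: "'a measure \<Rightarrow> ('a \<Rightarrow> 'a) \<Rightarrow> bool" where
  "invertible_map M T \<longleftrightarrow>
     bij_betw T (space M) (space M) \<and> inv_into (space M) T \<in> measurable M M"

definition measure_preserving_map :: "'a measure \<Rightarrow> ('a \<Rightarrow> 'a) \<Rightarrow> bool" where
  "measure_preserving_map M T \<longleftrightarrow>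
     (\<forall>E\<in>sets M. emeasure M (T -` E \<inter> space M) = emeasure M E)"

definition ergodic_map :: "'a measure \<Rightarrow> ('a \<Rightarrow> 'a) \<Rightarrow> bool" where
  "ergodic_map M T \<longleftrightarrow>
     (\<forall>E\<in>sets M. T -` E \<inter> space M = E \<longrightarrow> emeasure M E = 0 \<or> emeasure M (space M - E) = 0)"

definition conservative_map :: "'a measure \<Rightarrow> ('a \<Rightarrow> 'a) \<Rightarrow> bool" where
  "conservative_map M T \<longleftrightarrow>
     \<not> (\<exists>W\<in>sets M. emeasure M W > 0 \<and>
          disjoint_family (\<lambda>n::nat. (T ^^ n) -` W \<inter> space M))"

definition iterate_int :: "'a measure \<Rightarrow> ('a \<Rightarrow> 'a) \<Rightarrow> int \<Rightarrow> 'a \<Rightarrow> 'a" where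
  "iterate_int M T n =
     (if n \<ge> 0 then T ^^ nat n else inv_into (space M) T ^^ nat (- n))"

definition schroedinger_op ::
    "'a measure \<Rightarrow> ('a \<Rightarrow> 'a) \<Rightarrow> ('a \<Rightarrow> real) \<Rightarrow> 'a \<Rightarrow> (int \<Rightarrow> complex) \<Rightarrow> (int \<Rightarrow> complex)" where
  "schroedinger_op M T f \<omega> u =
     (\<lambda>n. u (n - 1) + u (n + 1) + complex_of_real (f (iterate_int M T n \<omega>)) * u n)"

lemma iterate_int_in_space:
  assumes "invertible_map M T" "\<omega> \<in> space M"
  shows "iterate_int M T n \<omega> \<in> space M"
proof -
  have T: "T x \<in> space M" "inv_into (space M) T x \<in> space M" if "x \<in> space M" for x
    using assms(1) that unfolding invertible_map_def bij_betw_def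
    by (auto intro: measurable_space)
  have "(T ^^ k) \<omega> \<in> space M" "(inv_into (space M) T ^^ k) \<omega> \<in> space M" for k
    by (induction k) (use T assms(2) in auto)
  then show ?thesis
    by (simp add: iterate_int_def)
qed

lemma shift_ell2:
  assumes "u \<in> ell2"
  shows "(\<lambda>n. u (n + k)) \<in> ell2"
    and "(\<Sum>\<^sub>\<infinity>n. (cmod (u (n + k)))\<^sup>2) = (\<Sum>\<^sub>\<infinity>n. (cmod (u n))\<^sup>2)"
proof -
  have b: "bij_betw (\<lambda>n::int. n + k) UNIV UNIV"
    by (rule bij_betwI[where g = "\<lambda>n. n - k"]) auto
  show "(\<lambda>n. u (n + k)) \<in> ell2"
    using assms summable_on_reindex_bij_betw[OF b, of "\<lambda>n. (cmod (u n))\<^sup>2"]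
    by (simp add: ell2_def)
  show "(\<Sum>\<^sub>\<infinity>n. (cmod (u (n + k)))\<^sup>2) = (\<Sum>\<^sub>\<infinity>n. (cmod (u n))\<^sup>2)"
    using infsum_reindex_bij_betw[OF b, of "\<lambda>n. (cmod (u n))\<^sup>2"] by simp
qed

lemma ell2_product_summable:
  assumes "u \<in> ell2" "v \<in> ell2"
  shows "(\<lambda>n. cnj (u n) * v n) summable_on UNIV"
proof -
  have "(\<lambda>n. norm (cnj (u n) * v n)) summable_on UNIV"
    by (rule abs_summable_product)
       (use assms in \<open>auto simp: ell2_def norm_mult power2_eq_square\<close>)
  then show ?thesis
    by (rule abs_summable_summable)
qed

lemma cmod_sum3_squared:
  "(cmod (a + b + c))\<^sup>2 \<le> 3 * ((cmod a)\<^sup>2 + (cmod b)\<^sup>2 + (cmod c)\<^sup>2)"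
proof -
  have "cmod (a + b + c) \<le> cmod a + cmod b + cmod c"
    by (meson add_right_mono norm_triangle_ineq order_trans)
  then have "(cmod (a + b + c))\<^sup>2 \<le> (cmod a + cmod b + cmod c)\<^sup>2"
    by (rule power_mono) simp
  also have "\<dots> \<le> 3 * ((cmod a)\<^sup>2 + (cmod b)\<^sup>2 + (cmod c)\<^sup>2)"
    using sum_squares_bound[of "cmod a" "cmod b"] sum_squares_bound[of "cmod a" "cmod c"]
      sum_squares_bound[of "cmod b" "cmod c"]
    by (simp add: power2_eq_square algebra_simps)
  finally show ?thesis .
qed

lemma potential_term_bound:
  assumes "\<bar>x\<bar> \<le> C"
  shows "(cmod (complex_of_real x * z))\<^sup>2 \<le> C\<^sup>2 * (cmod z)\<^sup>2"
  using power_mono[OF assms, of 2]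
  by (simp add: norm_mult power_mult_distrib mult_right_mono)

lemma schroedinger_op_bounded:
  assumes "invertible_map M T" "bounded (f ` space M)" "\<omega> \<in> space M"
  shows "ell2_bounded_op (schroedinger_op M T f \<omega>)"
proof -
  let ?H = "schroedinger_op M T f \<omega>"
  obtain C where C: "\<And>x. x \<in> space M \<Longrightarrow> \<bar>f x\<bar> \<le> C"
    using assms(2) by (auto simp: bounded_iff)
  define g where "g u n = 3 * ((cmod (u (n - 1)))\<^sup>2 + (cmod (u (n + 1)))\<^sup>2 + C\<^sup>2 * (cmod (u n))\<^sup>2)"
    for u :: "int \<Rightarrow> complex" and n
  have le: "(cmod (?H u n))\<^sup>2 \<le> g u n" for u n
  proof -
    have "(cmod (?H u n))\<^sup>2 \<le> 3 * ((cmod (u (n - 1)))\<^sup>2 + (cmod (u (n + 1)))\<^sup>2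
        + (cmod (complex_of_real (f (iterate_int M T n \<omega>)) * u n))\<^sup>2)"
      unfolding schroedinger_op_def by (rule cmod_sum3_squared)
    also have "\<dots> \<le> g u n"
      unfolding g_def
      by (intro mult_left_mono add_left_mono potential_term_bound C
          iterate_int_in_space[OF assms(1,3)]) auto
    finally show ?thesis .
  qed
  have g: "g u summable_on UNIV"
    "infsum (g u) UNIV = 3 * (2 + C\<^sup>2) * (\<Sum>\<^sub>\<infinity>n. (cmod (u n))\<^sup>2)" if u: "u \<in> ell2" for u
  proof -
    have s: "(\<lambda>n. (cmod (u n))\<^sup>2) summable_on UNIV"
      "(\<lambda>n. (cmod (u (n - 1)))\<^sup>2) summable_on UNIV"
      "(\<lambda>n. (cmod (u (n + 1)))\<^sup>2) summable_on UNIV"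
      using u shift_ell2(1)[OF u, of 1] shift_ell2(1)[OF u, of "-1"] by (auto simp: ell2_def)
    show "g u summable_on UNIV"
      unfolding g_def by (intro summable_on_cmult_right summable_on_add s)
    have "infsum (g u) UNIV = 3 * ((\<Sum>\<^sub>\<infinity>n. (cmod (u (n - 1)))\<^sup>2)
        + (\<Sum>\<^sub>\<infinity>n. (cmod (u (n + 1)))\<^sup>2) + C\<^sup>2 * (\<Sum>\<^sub>\<infinity>n. (cmod (u n))\<^sup>2))"
      unfolding g_def
      by (simp add: infsum_cmult_right' infsum_add summable_on_add summable_on_cmult_right s)
    then show "infsum (g u) UNIV = 3 * (2 + C\<^sup>2) * (\<Sum>\<^sub>\<infinity>n. (cmod (u n))\<^sup>2)"
      using shift_ell2(2)[OF u, of 1] shift_ell2(2)[OF u, of "-1"] by (simp add: algebra_simps)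
  qed
  have H: "?H u \<in> ell2" if u: "u \<in> ell2" for u
    unfolding ell2_def mem_Collect_eq
    by (rule summable_on_comparison_test[OF g(1)[OF u]]) (auto intro: le)
  have "ell2_norm (?H u) \<le> sqrt (3 * (2 + C\<^sup>2)) * ell2_norm u" if u: "u \<in> ell2" for u
  proof -
    have "(\<Sum>\<^sub>\<infinity>n. (cmod (?H u n))\<^sup>2) \<le> infsum (g u) UNIV"
      by (rule infsum_mono) (use H[OF u] g(1)[OF u] le in \<open>auto simp: ell2_def\<close>)
    then show ?thesis
      by (simp only: ell2_norm_def g(2)[OF u] real_sqrt_mult[symmetric] real_sqrt_le_iff)
  qed
  then have "\<exists>K. \<forall>u\<in>ell2. ell2_norm (?H u) \<le> K * ell2_norm u"
    by blast
  moreover have "?H (\<lambda>n. u n + v n) = (\<lambda>n. ?H u n + ?H v n)" for u v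
    by (simp add: schroedinger_op_def algebra_simps)
  moreover have "?H (\<lambda>n. c * u n) = (\<lambda>n. c * ?H u n)" for c u
    by (simp add: schroedinger_op_def algebra_simps)
  ultimately show ?thesis
    using H unfolding ell2_bounded_op_def by blast
qed

lemma schroedinger_op_selfadjoint:
  assumes "invertible_map M T" "bounded (f ` space M)" "\<omega> \<in> space M"
  shows "ell2_selfadjoint (schroedinger_op M T f \<omega>)"
proof -
  let ?H = "schroedinger_op M T f \<omega>" and ?V = "\<lambda>n. complex_of_real (f (iterate_int M T n \<omega>))"
  have "ell2_inner (?H u) v = ell2_inner u (?H v)" if u: "u \<in> ell2" and v: "v \<in> ell2" for u v
  proof -
    have sh: "(\<lambda>n. w (n - 1)) \<in> ell2" "(\<lambda>n. w (n + 1)) \<in> ell2" if "w \<in> ell2" for w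
      using shift_ell2(1)[OF that, of 1] shift_ell2(1)[OF that, of "-1"] by auto
    have bij: "bij_betw (\<lambda>n::int. n + 1) UNIV UNIV"
      by (rule bij_betwI[where g = "\<lambda>n. n - 1"]) auto
    note ps = ell2_product_summable
    have Hv: "?H v \<in> ell2"
      using schroedinger_op_bounded[OF assms] v by (auto simp: ell2_bounded_op_def)
    have V: "(\<lambda>n. cnj (u n) * (?V n * v n)) summable_on UNIV"
    proof -
      have m: "(\<lambda>n. - w n) \<in> ell2" if "w \<in> ell2" for w
        using that by (simp add: ell2_def)
      have "(\<lambda>n. cnj (u n) * ?H v n + cnj (u n) * - v (n - 1) + cnj (u n) * - v (n + 1)) summable_on UNIV"
        by (intro summable_on_add ps u Hv m sh v)
      then show ?thesis
        by (simp add: schroedinger_op_def algebra_simps)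
    qed
    have "ell2_inner (?H u) v =
        (\<Sum>\<^sub>\<infinity>n. cnj (u (n - 1)) * v n + cnj (u (n + 1)) * v n + cnj (u n) * (?V n * v n))"
      by (simp add: ell2_inner_def schroedinger_op_def algebra_simps)
    also have "\<dots> = (\<Sum>\<^sub>\<infinity>n. cnj (u (n - 1)) * v n) + (\<Sum>\<^sub>\<infinity>n. cnj (u (n + 1)) * v n)
        + (\<Sum>\<^sub>\<infinity>n. cnj (u n) * (?V n * v n))"
      by (simp add: infsum_add summable_on_add V ps[OF sh(1)[OF u] v] ps[OF sh(2)[OF u] v])
    also have "(\<Sum>\<^sub>\<infinity>n. cnj (u (n - 1)) * v n) = (\<Sum>\<^sub>\<infinity>n. cnj (u n) * v (n + 1))"
      using infsum_reindex_bij_betw[OF bij, of "\<lambda>n. cnj (u (n - 1)) * v n"] by simp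
    also have "(\<Sum>\<^sub>\<infinity>n. cnj (u (n + 1)) * v n) = (\<Sum>\<^sub>\<infinity>n. cnj (u n) * v (n - 1))"
      using infsum_reindex_bij_betw[OF bij, of "\<lambda>n. cnj (u n) * v (n - 1)"] by simp
    also have "(\<Sum>\<^sub>\<infinity>n. cnj (u n) * v (n + 1)) + (\<Sum>\<^sub>\<infinity>n. cnj (u n) * v (n - 1))
        + (\<Sum>\<^sub>\<infinity>n. cnj (u n) * (?V n * v n)) =
        (\<Sum>\<^sub>\<infinity>n. cnj (u n) * v (n + 1) + cnj (u n) * v (n - 1) + cnj (u n) * (?V n * v n))"
      by (simp add: infsum_add summable_on_add V ps[OF u sh(1)[OF v]] ps[OF u sh(2)[OF v]])
    also have "\<dots> = ell2_inner u (?H v)"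
      by (simp add: ell2_inner_def schroedinger_op_def algebra_simps)
    finally show ?thesis .
  qed
  then show ?thesis
    using schroedinger_op_bounded[OF assms] by (auto simp: ell2_selfadjoint_def)
qed

end

theory Submission
  imports Defs
begin

text \<open>A real \<open>x\<close> lies outside the spectrum of a self-adjoint \<open>A\<close> iff \<open>A - x\<close> is bounded below, and
  then \<open>A - q\<close> is bounded below by some rational \<open>c\<close> for a rational \<open>q\<close> with \<open>\<bar>x - q\<bar> < c\<close>.
  For each rational pair \<open>(q, c)\<close> the set of all \<open>\<omega>\<close> such that \<open>H\<^sub>\<omega> - q\<close> is bounded below by \<open>c\<close>
  is measurable, since it suffices to test countably many finitely supported vectors, and
  \<open>T\<close>-invariant, since \<open>H\<close> at \<open>T \<omega>\<close> is a shift of \<open>H\<^sub>\<omega>\<close>. By ergodicity it is null or conull, so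
  almost every resolvent set is the union of the intervals \<open>(q - c, q + c)\<close> over the
  conull pairs.\<close>

section \<open>The normed space \<open>ell2\<close> and its completeness\<close>

lemma ell2_norm_nonneg [simp]: "0 \<le> ell2_norm u"
  by (simp add: ell2_norm_def infsum_nonneg)

lemma ell2_norm_squared: "(ell2_norm u)\<^sup>2 = (\<Sum>\<^sub>\<infinity>n. (cmod (u n))\<^sup>2)"
  by (simp add: ell2_norm_def infsum_nonneg)

lemma L2_set_le_ell2_norm:
  assumes "u \<in> ell2" "finite F"
  shows "L2_set (\<lambda>n. cmod (u n)) F \<le> ell2_norm u"
  unfolding L2_set_def ell2_norm_def
  using assms by (auto simp: ell2_def intro!: finite_sum_le_infsum)

text \<open>All terms are nonnegative, so the full sum is the supremum of its finite partial sums.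
  Phrasing the bound with \<open>L2_set\<close> lets Minkowski's inequality for finite sums carry
  over to \<open>ell2\<close>.\<close>

lemma ell2_normI:
  assumes "\<And>F. finite F \<Longrightarrow> L2_set (\<lambda>n. cmod (u n)) F \<le> C"
  shows "u \<in> ell2" "ell2_norm u \<le> C"
proof -
  have "0 \<le> C" using assms[of "{}"] by simp
  have le: "(\<Sum>n\<in>F. (cmod (u n))\<^sup>2) \<le> C\<^sup>2" if "finite F" for F
    using assms[OF that] \<open>0 \<le> C\<close> unfolding L2_set_def
    by (metis real_sqrt_le_iff real_sqrt_abs abs_of_nonneg)
  then show u: "u \<in> ell2"
    unfolding ell2_def mem_Collect_eq
    by (intro nonneg_bdd_above_summable_on bdd_aboveI[of _ "C\<^sup>2"]) auto
  have "(\<Sum>\<^sub>\<infinity>n. (cmod (u n))\<^sup>2) \<le> C\<^sup>2"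
    using u le by (intro infsum_le_finite_sums) (auto simp: ell2_def)
  then show "ell2_norm u \<le> C"
    unfolding ell2_norm_def using \<open>0 \<le> C\<close> by (simp add: real_le_lsqrt infsum_nonneg)
qed

lemma cmod_le_ell2_norm: "u \<in> ell2 \<Longrightarrow> cmod (u n) \<le> ell2_norm u"
  using L2_set_le_ell2_norm[of u "{n}"] by simp

lemma ell2_norm_0_imp: "u \<in> ell2 \<Longrightarrow> ell2_norm u \<le> 0 \<Longrightarrow> u = (\<lambda>n. 0)"
  using cmod_le_ell2_norm[of u] by (meson ext norm_le_zero_iff order_trans)

lemma ell2_zero: "(\<lambda>n. 0) \<in> ell2" "ell2_norm (\<lambda>n. 0) = 0"
  by (simp_all add: ell2_def ell2_norm_def)

lemma ell2_add:
  assumes "u \<in> ell2" "v \<in> ell2"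
  shows "(\<lambda>n. u n + v n) \<in> ell2" "ell2_norm (\<lambda>n. u n + v n) \<le> ell2_norm u + ell2_norm v"
proof -
  have "L2_set (\<lambda>n. cmod (u n + v n)) F \<le> ell2_norm u + ell2_norm v" if "finite F" for F
  proof -
    have "L2_set (\<lambda>n. cmod (u n + v n)) F \<le> L2_set (\<lambda>n. cmod (u n) + cmod (v n)) F"
      by (intro L2_set_mono norm_triangle_ineq) auto
    also have "\<dots> \<le> L2_set (\<lambda>n. cmod (u n)) F + L2_set (\<lambda>n. cmod (v n)) F"
      by (rule L2_set_triangle_ineq)
    also have "\<dots> \<le> ell2_norm u + ell2_norm v"
      by (intro add_mono L2_set_le_ell2_norm assms that)
    finally show ?thesis .
  qed
  from ell2_normI[OF this]
  show "(\<lambda>n. u n + v n) \<in> ell2" "ell2_norm (\<lambda>n. u n + v n) \<le> ell2_norm u + ell2_norm v"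
    by auto
qed

lemma ell2_cmult:
  assumes "u \<in> ell2"
  shows "(\<lambda>n. c * u n) \<in> ell2"
  using assms by (auto simp: ell2_def norm_mult power_mult_distrib intro: summable_on_cmult_right)

lemma ell2_norm_cmult: "ell2_norm (\<lambda>n. c * u n) = cmod c * ell2_norm u"
  by (simp add: ell2_norm_def norm_mult power_mult_distrib infsum_cmult_right' real_sqrt_mult)

lemma ell2_diff:
  assumes "u \<in> ell2" "v \<in> ell2"
  shows "(\<lambda>n. u n - v n) \<in> ell2" "ell2_norm (\<lambda>n. u n - v n) \<le> ell2_norm u + ell2_norm v"
  using ell2_add[OF assms(1) ell2_cmult[OF assms(2), of "-1"]] ell2_norm_cmult[of "-1" v] by auto

lemma ell2_norm_diff_triangle:
  assumes "u \<in> ell2" "v \<in> ell2"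
  shows "ell2_norm u - ell2_norm v \<le> ell2_norm (\<lambda>n. u n - v n)"
  using ell2_add(2)[OF ell2_diff(1)[OF assms] assms(2)] by simp

lemma ell2_sum:
  assumes "\<And>k. k \<in> K \<Longrightarrow> v k \<in> ell2" "finite K"
  shows "(\<lambda>n. \<Sum>k\<in>K. v k n) \<in> ell2 \<and> ell2_norm (\<lambda>n. \<Sum>k\<in>K. v k n) \<le> (\<Sum>k\<in>K. ell2_norm (v k))"
  using assms(2,1)
proof (induction K rule: finite_induct)
  case empty
  show ?case by (simp add: ell2_zero)
next
  case (insert k K)
  then show ?case
    using ell2_add[of "v k" "\<lambda>n. \<Sum>k\<in>K. v k n"] by fastforce
qed

lemma ell2_norm_shift: "ell2_norm (\<lambda>n. u (n + k)) = ell2_norm u"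
proof -
  have "bij_betw (\<lambda>n::int. n + k) UNIV UNIV"
    by (rule bij_betwI[where g = "\<lambda>n. n - k"]) auto
  then show ?thesis
    using infsum_reindex_bij_betw[of "\<lambda>n. n + k" UNIV UNIV "\<lambda>n. (cmod (u n))\<^sup>2"]
    by (simp add: ell2_norm_def)
qed

text \<open>Completeness in the form that absolutely convergent series converge. Coordinates are
  dominated by norms, so the series converges pointwise, and the norm of the remainder is at most
  the tail of the series of norms.\<close>

lemma ell2_complete:
  assumes v: "\<And>k. v k \<in> ell2" and s: "summable (\<lambda>k. ell2_norm (v k))"
  obtains u where "u \<in> ell2" "(\<lambda>m. ell2_norm (\<lambda>n. u n - (\<Sum>k<m. v k n))) \<longlonglongrightarrow> 0"
proof -
  define u where "u n = (\<Sum>k. v k n)" for n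
  define t where "t m = (\<Sum>k. ell2_norm (v (k + m)))" for m
  have sv: "summable (\<lambda>k. v k n)" for n
    by (rule summable_comparison_test'[OF s]) (use v cmod_le_ell2_norm in auto)
  have "L2_set (\<lambda>n. cmod (u n - (\<Sum>k<m. v k n))) F \<le> t m" if F: "finite F" for F m
  \<comment> \<open>On a finite \<open>F\<close> the norm depends continuously on finitely many
    coordinates, so the bound for partial sums from \<open>m\<close> on survives the limit in
    \<open>j\<close>.\<close>
  proof (rule LIMSEQ_le_const2)
    have "(\<lambda>j. \<Sum>k<j. v (k + m) n) \<longlonglongrightarrow> u n - (\<Sum>k<m. v k n)" for n
      unfolding u_def suminf_minus_initial_segment[OF sv, symmetric]
      by (rule summable_LIMSEQ) (rule summable_ignore_initial_segment[OF sv])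
    then show "(\<lambda>j. L2_set (\<lambda>n. cmod (\<Sum>k<j. v (k + m) n)) F) \<longlonglongrightarrow>
        L2_set (\<lambda>n. cmod (u n - (\<Sum>k<m. v k n))) F"
      unfolding L2_set_def by (intro tendsto_intros)
    have "L2_set (\<lambda>n. cmod (\<Sum>k<j. v (k + m) n)) F \<le> t m" for j
    proof -
      have "L2_set (\<lambda>n. cmod (\<Sum>k<j. v (k + m) n)) F \<le> (\<Sum>k<j. ell2_norm (v (k + m)))"
        using L2_set_le_ell2_norm[OF _ F] ell2_sum[of "{..<j}" "\<lambda>k. v (k + m)"] v
        by (meson finite_lessThan order_trans)
      also have "\<dots> \<le> t m"
        unfolding t_def using summable_ignore_initial_segment[OF s] by (intro sum_le_suminf) auto
      finally show ?thesis .
    qed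
    then show "\<exists>N. \<forall>j\<ge>N. L2_set (\<lambda>n. cmod (\<Sum>k<j. v (k + m) n)) F \<le> t m"
      by blast
  qed
  note tail = ell2_normI[OF this]
  have "u \<in> ell2" using tail(1)[of 0] by simp
  moreover have "t \<longlonglongrightarrow> 0"
    unfolding t_def using suminf_exist_split2[OF s] by simp
  then have "(\<lambda>m. ell2_norm (\<lambda>n. u n - (\<Sum>k<m. v k n))) \<longlonglongrightarrow> 0"
    by (rule tendsto_sandwich[OF _ _ tendsto_const, rotated 2]) (auto simp: tail)
  ultimately show ?thesis using that by blast
qed

section \<open>Bounded operators and the Neumann series\<close>

lemma ell2_bounded_opD:
  assumes "ell2_bounded_op A" "u \<in> ell2"
  shows "A u \<in> ell2"
    and "v \<in> ell2 \<Longrightarrow> A (\<lambda>n. u n + v n) = (\<lambda>n. A u n + A v n)"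
    and "A (\<lambda>n. c * u n) = (\<lambda>n. c * A u n)"
    and "v \<in> ell2 \<Longrightarrow> A (\<lambda>n. u n - v n) = (\<lambda>n. A u n - A v n)"
proof -
  have c: "A (\<lambda>n. c * u n) = (\<lambda>n. c * A u n)" if "u \<in> ell2" for c u
    using assms that by (auto simp: ell2_bounded_op_def)
  show "A u \<in> ell2" "v \<in> ell2 \<Longrightarrow> A (\<lambda>n. u n + v n) = (\<lambda>n. A u n + A v n)"
    "A (\<lambda>n. c * u n) = (\<lambda>n. c * A u n)"
    using assms by (auto simp: ell2_bounded_op_def)
  show "A (\<lambda>n. u n - v n) = (\<lambda>n. A u n - A v n)" if v: "v \<in> ell2"
  proof -
    have "\<forall>u\<in>ell2. \<forall>v\<in>ell2. A (\<lambda>n. u n + v n) = (\<lambda>n. A u n + A v n)"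
      using assms(1) by (simp add: ell2_bounded_op_def)
    from bspec[OF bspec[OF this assms(2)] ell2_cmult[OF v, of "- 1"]]
    have "A (\<lambda>n. u n + (- 1) * v n) = (\<lambda>n. A u n + A (\<lambda>n. (- 1) * v n) n)" .
    then show ?thesis by (simp only: c[OF v]) simp
  qed
qed

lemma ell2_bounded_op_bound:
  assumes "ell2_bounded_op A"
  shows "\<exists>K>0. \<forall>u\<in>ell2. ell2_norm (A u) \<le> K * ell2_norm u"
proof -
  obtain K where "\<forall>u\<in>ell2. ell2_norm (A u) \<le> K * ell2_norm u"
    using assms by (auto simp: ell2_bounded_op_def)
  then have "ell2_norm (A u) \<le> max K 1 * ell2_norm u" if "u \<in> ell2" for u
    using that mult_right_mono[of K "max K 1" "ell2_norm u"] by fastforce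
  then show ?thesis by (intro exI[of _ "max K 1"]) auto
qed

lemma ell2_bounded_op_shift:
  assumes "ell2_bounded_op A"
  shows "ell2_bounded_op (\<lambda>u n. A u n - z * u n)"
proof -
  obtain K where K: "K > 0" "\<And>u. u \<in> ell2 \<Longrightarrow> ell2_norm (A u) \<le> K * ell2_norm u"
    using ell2_bounded_op_bound[OF assms] by blast
  have "ell2_norm (\<lambda>n. A u n - z * u n) \<le> (K + cmod z) * ell2_norm u" if "u \<in> ell2" for u
    using ell2_diff(2)[OF ell2_bounded_opD(1)[OF assms that] ell2_cmult[OF that, of z]] K(2)[OF that]
    by (simp add: ell2_norm_cmult algebra_simps)
  then have "\<exists>K. \<forall>u\<in>ell2. ell2_norm (\<lambda>n. A u n - z * u n) \<le> K * ell2_norm u"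
    by blast
  then show ?thesis
    unfolding ell2_bounded_op_def
    by (simp add: ell2_bounded_opD[OF assms] ell2_diff(1) ell2_cmult algebra_simps)
qed

text \<open>The solution is the sum of the series of \<open>(R ^^ k) y\<close>, whose norms decay
  geometrically. Continuity of \<open>R\<close> enters only through the contraction
  estimate.\<close>

lemma ell2_neumann:
  assumes R: "ell2_bounded_op R" and r: "0 \<le> r" "r < 1"
    and le: "\<And>u. u \<in> ell2 \<Longrightarrow> ell2_norm (R u) \<le> r * ell2_norm u" and y: "y \<in> ell2"
  obtains u where "u \<in> ell2" "(\<lambda>n. u n - R u n) = y"
proof -
  define v where "v k = (R ^^ k) y" for k
  have v: "v k \<in> ell2" for k
    unfolding v_def by (induction k) (use y ell2_bounded_opD(1)[OF R] in auto)
  have "ell2_norm (v k) \<le> r ^ k * ell2_norm y" for k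
  proof (induction k)
    case (Suc k)
    have "ell2_norm (v (Suc k)) \<le> r * ell2_norm (v k)"
      using le[OF v] by (simp add: v_def)
    also have "\<dots> \<le> r * (r ^ k * ell2_norm y)"
      using Suc r by (intro mult_left_mono) auto
    finally show ?case by (simp add: algebra_simps)
  qed (simp add: v_def)
  then have "summable (\<lambda>k. ell2_norm (v k))"
    using r by (intro summable_comparison_test'[OF summable_mult2[OF summable_geometric[of r]]]) auto
  with v obtain u where u: "u \<in> ell2"
    and lim: "(\<lambda>m. ell2_norm (\<lambda>n. u n - (\<Sum>k<m. v k n))) \<longlonglongrightarrow> 0"
    by (rule ell2_complete)
  define S where "S m = (\<lambda>n. \<Sum>k<m. v k n)" for m
  have S: "S m \<in> ell2" for m
    unfolding S_def using ell2_sum[of "{..<m}" v] v by blast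
  \<comment> \<open>Applying \<open>R\<close> moves every term one place up, so only the leading
    term \<open>y\<close> of the next partial sum is missing.\<close>
  have RS: "R (S m) = (\<lambda>n. S (Suc m) n - y n)" for m
  proof (induction m)
    case 0
    show ?case
      using ell2_bounded_opD(3)[OF R y, of 0] by (simp add: S_def v_def)
  next
    case (Suc m)
    have "R (S (Suc m)) = R (\<lambda>n. S m n + v m n)" by (simp add: S_def)
    also have "\<dots> = (\<lambda>n. R (S m) n + v (Suc m) n)"
      using ell2_bounded_opD(2)[OF R S v] by (simp add: v_def)
    finally have e: "R (S (Suc m)) = (\<lambda>n. R (S m) n + v (Suc m) n)" .
    show ?case
      unfolding e Suc by (simp add: S_def algebra_simps)
  qed
  have d: "(\<lambda>n. u n - S m n) \<in> ell2" for m
    using ell2_diff(1)[OF u S] .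
  have z: "(\<lambda>n. u n - R u n - y n) \<in> ell2"
    using ell2_diff(1)[OF ell2_diff(1)[OF u ell2_bounded_opD(1)[OF R u]] y] .
  \<comment> \<open>The residual does not depend on \<open>m\<close>, while the right-hand side is
    built from approximation errors that tend to zero; hence the residual vanishes.\<close>
  have "ell2_norm (\<lambda>n. u n - R u n - y n) \<le>
      ell2_norm (\<lambda>n. u n - S (Suc m) n) + r * ell2_norm (\<lambda>n. u n - S m n)" for m
  proof -
    have "(\<lambda>n. u n - R u n - y n) = (\<lambda>n. (u n - S (Suc m) n) - R (\<lambda>n. u n - S m n) n)"
      by (rule ext) (simp add: ell2_bounded_opD(4)[OF R u S] RS)
    then show ?thesis
      using ell2_diff(2)[OF d[of "Suc m"] ell2_bounded_opD(1)[OF R d[of m]]] le[OF d[of m]] by simp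
  qed
  moreover have "(\<lambda>m. ell2_norm (\<lambda>n. u n - S (Suc m) n) + r * ell2_norm (\<lambda>n. u n - S m n)) \<longlonglongrightarrow> 0 + r * 0"
    using lim LIMSEQ_Suc[OF lim] unfolding S_def by (intro tendsto_intros)
  ultimately have "ell2_norm (\<lambda>n. u n - R u n - y n) \<le> 0"
    using LIMSEQ_le_const by fastforce
  from ell2_norm_0_imp[OF z this] have "(\<lambda>n. u n - R u n) = y"
    by (metis (no_types, lifting) eq_iff_diff_eq_0 ext)
  with u show ?thesis using that by blast
qed

section \<open>Inner product identities and self-adjointness\<close>

lemma ell2_inner_commute: "ell2_inner u v = cnj (ell2_inner v u)"
  unfolding ell2_inner_def by (subst infsum_cnj[symmetric]) (simp add: mult.commute)

lemma ell2_inner_self: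
  assumes "u \<in> ell2"
  shows "ell2_inner u u = complex_of_real ((ell2_norm u)\<^sup>2)"
proof -
  have s: "(\<lambda>n. (cmod (u n))\<^sup>2) summable_on UNIV" using assms by (simp add: ell2_def)
  have "ell2_inner u u = (\<Sum>\<^sub>\<infinity>n. complex_of_real ((cmod (u n))\<^sup>2))"
    unfolding ell2_inner_def by (rule infsum_cong) (metis complex_norm_square mult.commute)
  also have "\<dots> = complex_of_real (\<Sum>\<^sub>\<infinity>n. (cmod (u n))\<^sup>2)"
    by (rule infsumI) (intro has_sum_of_real has_sum_infsum s)
  finally show ?thesis by (simp add: ell2_norm_squared)
qed

lemma ell2_inner_diff_cmult_right:
  assumes "u \<in> ell2" "v \<in> ell2" "w \<in> ell2"
  shows "ell2_inner u (\<lambda>n. v n - c * w n) = ell2_inner u v - c * ell2_inner u w"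
proof -
  note s = ell2_product_summable[OF assms(1,2)] ell2_product_summable[OF assms(1,3)]
  have "ell2_inner u (\<lambda>n. v n - c * w n) = (\<Sum>\<^sub>\<infinity>n. cnj (u n) * v n + - c * (cnj (u n) * w n))"
    unfolding ell2_inner_def by (simp add: algebra_simps)
  also have "\<dots> = ell2_inner u v + (\<Sum>\<^sub>\<infinity>n. - c * (cnj (u n) * w n))"
    unfolding ell2_inner_def by (intro infsum_add s summable_on_cmult_right)
  also have "\<dots> = ell2_inner u v - c * ell2_inner u w"
    unfolding ell2_inner_def infsum_cmult_right' by simp
  finally show ?thesis .
qed

lemma ell2_inner_diff_cmult_left:
  assumes "u \<in> ell2" "v \<in> ell2" "w \<in> ell2"
  shows "ell2_inner (\<lambda>n. v n - c * w n) u = ell2_inner v u - cnj c * ell2_inner w u"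
  unfolding ell2_inner_commute[of _ u] ell2_inner_diff_cmult_right[OF assms] by simp

lemma ell2_norm_diff_squared:
  assumes "u \<in> ell2" "v \<in> ell2"
  shows "(ell2_norm (\<lambda>n. u n - c * v n))\<^sup>2 =
    (ell2_norm u)\<^sup>2 - 2 * Re (c * ell2_inner u v) + (cmod c)\<^sup>2 * (ell2_norm v)\<^sup>2"
proof -
  let ?w = "\<lambda>n. u n - c * v n"
  have w: "?w \<in> ell2" by (intro ell2_diff ell2_cmult assms)
  have "complex_of_real ((ell2_norm ?w)\<^sup>2) = ell2_inner u u - c * ell2_inner u v
      - cnj c * (ell2_inner v u - c * ell2_inner v v)"
    unfolding ell2_inner_self[OF w, symmetric] ell2_inner_diff_cmult_left[OF w assms]
    by (simp only: ell2_inner_diff_cmult_right[OF assms(1) assms]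
        ell2_inner_diff_cmult_right[OF assms(2) assms])
  also have "ell2_inner v u = cnj (ell2_inner u v)"
    by (rule ell2_inner_commute)
  finally have "(ell2_norm ?w)\<^sup>2 = Re (complex_of_real ((ell2_norm u)\<^sup>2) - c * ell2_inner u v
      - cnj c * (cnj (ell2_inner u v) - c * complex_of_real ((ell2_norm v)\<^sup>2)))"
    unfolding ell2_inner_self[OF assms(1)] ell2_inner_self[OF assms(2)] by (metis Re_complex_of_real)
  then show ?thesis
    unfolding cmod_power2 by (simp add: algebra_simps power2_eq_square)
qed

text \<open>For self-adjoint \<open>A\<close> the number \<open>ell2_inner (A u) u\<close> is real,
  so in the expansion of the square the imaginary part of \<open>z\<close> contributes no cross
  term.\<close>

lemma selfadjoint_norm_shift_squared:
  assumes A: "ell2_selfadjoint A" and u: "u \<in> ell2"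
  shows "(ell2_norm (\<lambda>n. A u n - z * u n))\<^sup>2 =
    (ell2_norm (\<lambda>n. A u n - complex_of_real (Re z) * u n))\<^sup>2 + (Im z)\<^sup>2 * (ell2_norm u)\<^sup>2"
proof -
  have Au: "A u \<in> ell2"
    using A u ell2_bounded_opD(1) by (auto simp: ell2_selfadjoint_def)
  have "ell2_inner (A u) u = cnj (ell2_inner (A u) u)"
    using A u ell2_inner_commute[of u "A u"] by (auto simp: ell2_selfadjoint_def)
  then have "Im (ell2_inner (A u) u) = 0"
    by (simp add: complex_eq_iff)
  then show ?thesis
    unfolding ell2_norm_diff_squared[OF Au u] by (simp add: cmod_power2 algebra_simps)
qed

section \<open>Invertibility and lower bounds\<close>

lemma ell2_invertible_imp_bounded_below:
  assumes "ell2_invertible A" "\<And>u. u \<in> ell2 \<Longrightarrow> A u \<in> ell2"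
  shows "\<exists>c>0. \<forall>u\<in>ell2. c * ell2_norm u \<le> ell2_norm (A u)"
proof -
  obtain B where B: "ell2_bounded_op B" "\<And>u. u \<in> ell2 \<Longrightarrow> B (A u) = u"
    using assms(1) by (auto simp: ell2_invertible_def)
  obtain K where K: "K > 0" "\<And>u. u \<in> ell2 \<Longrightarrow> ell2_norm (B u) \<le> K * ell2_norm u"
    using ell2_bounded_op_bound[OF B(1)] by blast
  have "1 / K * ell2_norm u \<le> ell2_norm (A u)" if "u \<in> ell2" for u
    using K(2)[OF assms(2)[OF that]] B(2)[OF that] K(1) by (simp add: field_simps)
  then show ?thesis
    using K(1) by (intro exI[of _ "1 / K"]) auto
qed

text \<open>The lower bound makes \<open>A\<close> injective and bounds any right inverse by
  \<open>1 / c\<close>; linearity of a chosen right inverse then follows by applying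
  \<open>A\<close> to both sides and cancelling.\<close>

lemma bounded_below_surj_imp_ell2_invertible:
  assumes A: "ell2_bounded_op A" and c: "c > 0"
    and low: "\<And>u. u \<in> ell2 \<Longrightarrow> c * ell2_norm u \<le> ell2_norm (A u)"
    and surj: "\<And>y. y \<in> ell2 \<Longrightarrow> \<exists>u\<in>ell2. A u = y"
  shows "ell2_invertible A"
proof -
  have inj: "u = v" if "u \<in> ell2" "v \<in> ell2" "A u = A v" for u v
  proof -
    have "c * ell2_norm (\<lambda>n. u n - v n) \<le> 0"
      using low[OF ell2_diff(1)[OF that(1,2)]] ell2_bounded_opD(4)[OF A that(1,2)] that(3)
      by (simp add: ell2_zero)
    then have "ell2_norm (\<lambda>n. u n - v n) \<le> 0"
      using c by (simp add: mult_le_0_iff)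
    from ell2_norm_0_imp[OF ell2_diff(1)[OF that(1,2)] this] show ?thesis
      by (metis (no_types, lifting) eq_iff_diff_eq_0 ext)
  qed
  obtain B where B: "\<And>y. y \<in> ell2 \<Longrightarrow> B y \<in> ell2" "\<And>y. y \<in> ell2 \<Longrightarrow> A (B y) = y"
    using bchoice[of ell2 "\<lambda>y u. u \<in> ell2 \<and> A u = y"] surj by blast
  have "B (\<lambda>n. u n + v n) = (\<lambda>n. B u n + B v n)" if "u \<in> ell2" "v \<in> ell2" for u v
    by (rule inj) (simp_all add: that B ell2_add(1) ell2_bounded_opD[OF A])
  moreover have "B (\<lambda>n. c * u n) = (\<lambda>n. c * B u n)" if "u \<in> ell2" for u c
    by (rule inj) (simp_all add: that B ell2_cmult ell2_bounded_opD[OF A])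
  moreover have "ell2_norm (B u) \<le> 1 / c * ell2_norm u" if "u \<in> ell2" for u
    using low[OF B(1)[OF that]] B(2)[OF that] c by (simp add: field_simps)
  ultimately have "ell2_bounded_op B"
    using B(1) unfolding ell2_bounded_op_def by blast
  moreover have "B (A u) = u" if "u \<in> ell2" for u
    by (rule inj) (simp_all add: that B ell2_bounded_opD[OF A])
  ultimately show ?thesis
    using B unfolding ell2_invertible_def by blast
qed

text \<open>With \<open>B = A - z\<close> and a small \<open>t > 0\<close>, the lower bound turns \<open>1 - t B B\<^sup>*\<close> into a strict
  contraction, so that the Neumann series inverts \<open>B B\<^sup>*\<close> and \<open>B\<close> is onto.\<close>

lemma selfadjoint_bounded_below_imp_invertible:
  assumes A: "ell2_selfadjoint A" and c: "c > 0"
    and low: "\<And>u. u \<in> ell2 \<Longrightarrow> c * ell2_norm u \<le> ell2_norm (\<lambda>n. A u n - z * u n)"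
  shows "ell2_invertible (\<lambda>u n. A u n - z * u n)"
proof -
  define B where "B = (\<lambda>u n. A u n - z * u n)"
  define B' where "B' = (\<lambda>u n. A u n - cnj z * u n)"
  have bA: "ell2_bounded_op A" using A by (simp add: ell2_selfadjoint_def)
  have bB: "ell2_bounded_op B" and bB': "ell2_bounded_op B'"
    unfolding B_def B'_def by (rule ell2_bounded_op_shift[OF bA])+
  have adj: "ell2_inner u (B v) = ell2_inner (B' u) v" if "u \<in> ell2" "v \<in> ell2" for u v
    unfolding B_def B'_def
    using that A ell2_inner_diff_cmult_right[of u "A v" v] ell2_inner_diff_cmult_left[of v "A u" u]
      ell2_bounded_opD(1)[OF bA] by (simp add: ell2_selfadjoint_def)
  have "(ell2_norm (B' u))\<^sup>2 = (ell2_norm (B u))\<^sup>2" if "u \<in> ell2" for u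
    unfolding B_def B'_def
    using selfadjoint_norm_shift_squared[OF A that, of z]
      selfadjoint_norm_shift_squared[OF A that, of "cnj z"] by simp
  \<comment> \<open>\<open>z\<close> and \<open>cnj z\<close> differ only in the sign of the
    imaginary part, which enters squared. Thus the lower bound for \<open>B\<close> holds for its
    adjoint \<open>B'\<close> as well.\<close>
  then have norm: "ell2_norm (B' u) = ell2_norm (B u)" if "u \<in> ell2" for u
    using that by (simp add: power2_eq_iff_nonneg)
  obtain K0 where K0: "K0 > 0" "\<And>u. u \<in> ell2 \<Longrightarrow> ell2_norm (B u) \<le> K0 * ell2_norm u"
    using ell2_bounded_op_bound[OF bB] by blast
  \<comment> \<open>Taking \<open>K\<close> at least \<open>c\<close> keeps
    \<open>1 - (c / K)\<^sup>2\<close> nonnegative, so that its square root \<open>r\<close> is a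
    genuine contraction constant.\<close>
  define K where "K = max K0 c"
  have K: "ell2_norm (B u) \<le> K * ell2_norm u" if "u \<in> ell2" for u
    using K0 c K0(2)[OF that] mult_right_mono[of K0 K "ell2_norm u"] unfolding K_def by fastforce
  have K_pos: "K > 0" "c \<le> K" using c by (auto simp: K_def)
  \<comment> \<open>This \<open>t\<close> minimises \<open>- 2 * t + t\<^sup>2 * K\<^sup>2\<close>,
    the factor of the squared norm of \<open>B' u\<close> in the estimate below; the minimum is
    \<open>- t\<close>.\<close>
  define t where "t = 1 / K\<^sup>2"
  define r where "r = sqrt (1 - (c / K)\<^sup>2)"
  have cK: "(c / K)\<^sup>2 \<le> 1" "0 < (c / K)\<^sup>2" using K_pos c by (auto simp: power_le_one)
  then have r: "0 \<le> r" "r < 1" by (auto simp: r_def)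
  define R where "R = (\<lambda>u n. u n - complex_of_real t * B (B' u) n)"
  have BB': "B (B' u) \<in> ell2" if "u \<in> ell2" for u
    using ell2_bounded_opD(1) bB bB' that by blast
  have Rle: "ell2_norm (R u) \<le> r * ell2_norm u" if u: "u \<in> ell2" for u
  proof -
    have B'u: "B' u \<in> ell2" using ell2_bounded_opD(1)[OF bB' u] .
    have "(ell2_norm (R u))\<^sup>2 = (ell2_norm u)\<^sup>2 - 2 * t * (ell2_norm (B' u))\<^sup>2
        + t\<^sup>2 * (ell2_norm (B (B' u)))\<^sup>2"
      unfolding R_def ell2_norm_diff_squared[OF u BB'[OF u]] adj[OF u B'u] ell2_inner_self[OF B'u]
      by simp
    also have "\<dots> \<le> (ell2_norm u)\<^sup>2 - 2 * t * (ell2_norm (B' u))\<^sup>2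
        + t\<^sup>2 * (K * ell2_norm (B' u))\<^sup>2"
      by (intro add_left_mono mult_left_mono power_mono K[OF B'u]) auto
    also have "\<dots> = (ell2_norm u)\<^sup>2 - t * (ell2_norm (B' u))\<^sup>2"
      using K_pos by (simp add: t_def power2_eq_square field_simps)
    also have "\<dots> \<le> (ell2_norm u)\<^sup>2 - t * (c * ell2_norm u)\<^sup>2"
      using low[OF u] norm[OF u] c unfolding B_def[symmetric]
      by (intro diff_left_mono mult_left_mono power_mono) (auto simp: t_def B_def)
    also have "\<dots> = (r * ell2_norm u)\<^sup>2"
      using cK by (simp add: r_def t_def power_mult_distrib power_divide algebra_simps)
    finally show ?thesis
      using r by (simp add: power2_le_iff_abs_le)
  qed
  have "ell2_bounded_op R"
    unfolding ell2_bounded_op_def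
  proof (intro conjI ballI allI)
    show "\<exists>K. \<forall>u\<in>ell2. ell2_norm (R u) \<le> K * ell2_norm u" using Rle by blast
  qed (auto simp: R_def BB' ell2_diff(1) ell2_cmult ell2_bounded_opD[OF bB] ell2_bounded_opD[OF bB']
      algebra_simps)
  have surj: "\<exists>u\<in>ell2. B u = y" if y: "y \<in> ell2" for y
  proof -
    \<comment> \<open>Since \<open>1 - R\<close> is \<open>t\<close> times \<open>B B'\<close>,
      scaling \<open>y\<close> by \<open>t\<close> leaves \<open>B (B' w) = y\<close> after
      cancellation.\<close>
    obtain w where w: "w \<in> ell2" "(\<lambda>n. w n - R w n) = (\<lambda>n. complex_of_real t * y n)"
      using ell2_neumann[OF \<open>ell2_bounded_op R\<close> r Rle ell2_cmult[OF y, of "complex_of_real t"]] by metis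
    have "complex_of_real t \<noteq> 0" using K_pos by (simp add: t_def)
    then have "B (B' w) = y"
      using fun_cong[OF w(2)] by (intro ext) (simp add: R_def)
    then show ?thesis
      using ell2_bounded_opD(1)[OF bB' w(1)] by blast
  qed
  show ?thesis
    using bounded_below_surj_imp_ell2_invertible[OF bB c] low surj unfolding B_def by blast
qed

section \<open>The spectrum described by lower bounds\<close>

definition bounded_below_op :: "((int \<Rightarrow> complex) \<Rightarrow> (int \<Rightarrow> complex)) \<Rightarrow> real \<Rightarrow> real \<Rightarrow> bool" where
  "bounded_below_op A x c \<longleftrightarrow>
     (\<forall>u\<in>ell2. c * ell2_norm u \<le> ell2_norm (\<lambda>n. A u n - complex_of_real x * u n))"

text \<open>Off the real axis \<open>\<bar>Im z\<bar>\<close> is itself a lower bound for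
  \<open>A - z\<close>, so the spectrum is real. At real points invertibility and a positive lower
  bound imply each other.\<close>

lemma ell2_spectrum_selfadjoint:
  assumes A: "ell2_selfadjoint A"
  shows "ell2_spectrum A = complex_of_real ` {x. \<nexists>c. c > 0 \<and> bounded_below_op A x c}"
proof -
  have bA: "ell2_bounded_op A" using A by (simp add: ell2_selfadjoint_def)
  have real: "z \<notin> ell2_spectrum A" if "Im z \<noteq> 0" for z
  proof -
    have "\<bar>Im z\<bar> * ell2_norm u \<le> ell2_norm (\<lambda>n. A u n - z * u n)" if "u \<in> ell2" for u
    proof -
      have "(\<bar>Im z\<bar> * ell2_norm u)\<^sup>2 \<le> (ell2_norm (\<lambda>n. A u n - z * u n))\<^sup>2"
        using selfadjoint_norm_shift_squared[OF A that, of z] by (simp add: power_mult_distrib)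
      then show ?thesis by (rule power2_le_imp_le) simp
    qed
    then show ?thesis
      using selfadjoint_bounded_below_imp_invertible[OF A] that
      unfolding ell2_spectrum_def by (metis (mono_tags) mem_Collect_eq zero_less_abs_iff)
  qed
  have "complex_of_real x \<notin> ell2_spectrum A \<longleftrightarrow> (\<exists>c>0. bounded_below_op A x c)" for x
    using selfadjoint_bounded_below_imp_invertible[OF A, of _ "complex_of_real x"]
      ell2_invertible_imp_bounded_below[of "\<lambda>u n. A u n - complex_of_real x * u n"]
      ell2_bounded_opD(1)[OF ell2_bounded_op_shift[OF bA]]
    unfolding ell2_spectrum_def bounded_below_op_def by auto
  moreover have "z = complex_of_real (Re z)" if "z \<in> ell2_spectrum A" for z
    using real that by (simp add: complex_eq_iff) blast
  ultimately show ?thesis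
    by (auto simp: image_iff) (metis)+
qed

lemma bounded_below_op_perturb:
  assumes A: "ell2_bounded_op A" and "bounded_below_op A x c"
  shows "bounded_below_op A y (c - \<bar>y - x\<bar>)"
  unfolding bounded_below_op_def
proof
  fix u assume u: "u \<in> ell2"
  have sh: "(\<lambda>n. A u n - complex_of_real s * u n) \<in> ell2" for s
    using ell2_bounded_opD(1)[OF ell2_bounded_op_shift[OF A] u] .
  have "c * ell2_norm u \<le> ell2_norm (\<lambda>n. A u n - complex_of_real x * u n)"
    using assms(2) u by (simp add: bounded_below_op_def)
  also have "\<dots> = ell2_norm (\<lambda>n. (A u n - complex_of_real y * u n) + complex_of_real (y - x) * u n)"
    by (simp add: algebra_simps)
  also have "\<dots> \<le> ell2_norm (\<lambda>n. A u n - complex_of_real y * u n) + \<bar>y - x\<bar> * ell2_norm u"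
    using ell2_add(2)[OF sh ell2_cmult[OF u, of "complex_of_real (y - x)"]]
    by (simp only: ell2_norm_cmult norm_of_real)
  finally show "(c - \<bar>y - x\<bar>) * ell2_norm u \<le> ell2_norm (\<lambda>n. A u n - complex_of_real y * u n)"
    by (simp add: algebra_simps)
qed

text \<open>Lower bounds are stable: moving the point by some distance costs at most that distance
  in the constant. The strict inequality on the right forces the rational constant to be positive
  and leaves a positive constant at \<open>x\<close>.\<close>

lemma ex_bounded_below_op_rational:
  assumes A: "ell2_bounded_op A"
  shows "(\<exists>c>0. bounded_below_op A x c) \<longleftrightarrow>
    (\<exists>q c::rat. \<bar>x - of_rat q\<bar> < of_rat c \<and> bounded_below_op A (of_rat q) (of_rat c))"
proof
  assume "\<exists>c>0. bounded_below_op A x c"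
  then obtain c where c: "c > 0" "bounded_below_op A x c" by blast
  \<comment> \<open>With \<open>q\<close> within \<open>c / 3\<close> of \<open>x\<close>, the
    constant left at \<open>q\<close> exceeds \<open>2 * c / 3\<close>; a rational \<open>d\<close>
    between \<open>c / 3\<close> and that value is both a valid lower bound and larger than the
    distance from \<open>x\<close> to \<open>q\<close>.\<close>
  obtain q :: rat where q: "x < of_rat q" "of_rat q < x + c / 3"
    using of_rat_dense[of x "x + c / 3"] c(1) by auto
  obtain d :: rat where d: "c / 3 < of_rat d" "of_rat d < c * 2 / 3"
    using of_rat_dense[of "c / 3" "c * 2 / 3"] c(1) by auto
  have "bounded_below_op A (of_rat q) (c - \<bar>of_rat q - x\<bar>)"
    by (rule bounded_below_op_perturb[OF A c(2)])
  moreover have "of_rat d \<le> c - \<bar>of_rat q - x\<bar>" using q d by auto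
  ultimately have "bounded_below_op A (of_rat q) (of_rat d)"
    unfolding bounded_below_op_def by (meson ell2_norm_nonneg mult_right_mono order_trans)
  moreover have "\<bar>x - of_rat q\<bar> < of_rat d" using q d by auto
  ultimately show "\<exists>q c::rat. \<bar>x - of_rat q\<bar> < of_rat c \<and> bounded_below_op A (of_rat q) (of_rat c)"
    by blast
next
  assume "\<exists>q c::rat. \<bar>x - of_rat q\<bar> < of_rat c \<and> bounded_below_op A (of_rat q) (of_rat c)"
  then obtain q c :: rat where "\<bar>x - of_rat q\<bar> < of_rat c" "bounded_below_op A (of_rat q) (of_rat c)"
    by blast
  then show "\<exists>c>0. bounded_below_op A x c"
    using bounded_below_op_perturb[OF A, of "of_rat q" "of_rat c" x]
    by (intro exI[of _ "of_rat c - \<bar>x - of_rat q\<bar>"]) auto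
qed

text \<open>Beyond the operator bound \<open>K\<close> the multiple of the identity dominates, with
  lower bound \<open>\<bar>x\<bar> - K\<close>. This later gives boundedness of the
  spectrum.\<close>

lemma bounded_below_op_large:
  assumes A: "ell2_bounded_op A"
  shows "\<exists>K. \<forall>x. \<bar>x\<bar> > K \<longrightarrow> (\<exists>c>0. bounded_below_op A x c)"
proof -
  obtain K where K: "K > 0" "\<And>u. u \<in> ell2 \<Longrightarrow> ell2_norm (A u) \<le> K * ell2_norm u"
    using ell2_bounded_op_bound[OF A] by blast
  have "bounded_below_op A x (\<bar>x\<bar> - K)" for x
    unfolding bounded_below_op_def
  proof
    fix u assume u: "u \<in> ell2"
    let ?xu = "\<lambda>n. complex_of_real x * u n"
    have xu: "?xu \<in> ell2" by (rule ell2_cmult[OF u])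
    have "ell2_norm ?xu - ell2_norm (A u) \<le> ell2_norm (\<lambda>n. ?xu n - A u n)"
      by (rule ell2_norm_diff_triangle[OF xu ell2_bounded_opD(1)[OF A u]])
    also have "\<dots> = ell2_norm (\<lambda>n. A u n - ?xu n)"
      by (simp add: ell2_norm_def norm_minus_commute)
    finally show "(\<bar>x\<bar> - K) * ell2_norm u \<le> ell2_norm (\<lambda>n. A u n - ?xu n)"
      using K(2)[OF u] by (simp add: ell2_norm_cmult algebra_simps)
  qed
  then show ?thesis
    by (intro exI[of _ K]) (metis diff_gt_0_iff_gt)
qed

section \<open>Reduction to countably many test vectors\<close>

text \<open>Finitely supported vectors with entries in a countable dense set of complex numbers
  suffice. Encoding them as association lists makes countability immediate.\<close>

lemma ell2_countable_dense:
  obtains D where "countable D" "D \<subseteq> ell2" "\<And>d. d \<in> D \<Longrightarrow> finite {n. d n \<noteq> 0}"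
    "\<And>u e. u \<in> ell2 \<Longrightarrow> e > 0 \<Longrightarrow> \<exists>d\<in>D. ell2_norm (\<lambda>n. u n - d n) < e"
proof -
  obtain Q :: "complex set" where Q: "countable Q"
    and dense: "\<And>X. open X \<Longrightarrow> X \<noteq> {} \<Longrightarrow> \<exists>q\<in>Q. q \<in> X"
    using countable_dense_exists[where 'a = complex] by blast
  define g :: "(int \<times> complex) list \<Rightarrow> int \<Rightarrow> complex"
    where "g l n = (case map_of l n of None \<Rightarrow> 0 | Some q \<Rightarrow> q)" for l n
  define D where "D = g ` lists (UNIV \<times> Q)"
  have supp: "finite {n. g l n \<noteq> 0}" for l
    by (rule finite_subset[OF _ finite_dom_map_of[of l]]) (auto simp: g_def split: option.splits)
  have fin: "finite {n. d n \<noteq> 0}" if "d \<in> D" for d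
    using that supp by (auto simp: D_def)
  have "d \<in> ell2" if "d \<in> D" for d
  proof -
    have "(\<lambda>n. (cmod (d n))\<^sup>2) summable_on {n. d n \<noteq> 0}"
      by (rule summable_on_finite[OF fin[OF that]])
    then show ?thesis
      unfolding ell2_def mem_Collect_eq by (rule summable_on_cong_neutral[THEN iffD1, rotated -1]) auto
  qed
  moreover have "countable D"
    unfolding D_def using Q by (intro countable_image countable_lists countable_SIGMA) auto
  moreover have "\<exists>d\<in>D. ell2_norm (\<lambda>n. u n - d n) < e" if u: "u \<in> ell2" and e: "e > 0" for u e
  proof -
    define S where "S = (\<Sum>\<^sub>\<infinity>n. (cmod (u n))\<^sup>2)"
    \<comment> \<open>Two squared errors of at most \<eta> each, one on \<open>F\<close> and one
      from the tail outside \<open>F\<close>, add up to \<open>(e / 2)\<^sup>2\<close>; halving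
      \<open>e\<close> makes the final inequality strict.\<close>
    define \<eta> where "\<eta> = e\<^sup>2 / 8"
    have \<eta>: "\<eta> > 0" using e by (simp add: \<eta>_def)
    have su: "(\<lambda>n. (cmod (u n))\<^sup>2) summable_on UNIV" using u by (simp add: ell2_def)
    have "(sum (\<lambda>n. (cmod (u n))\<^sup>2) \<longlongrightarrow> S) (finite_subsets_at_top UNIV)"
      using has_sum_infsum[OF su] by (simp add: has_sum_def S_def)
    from order_tendstoD(1)[OF this, of "S - \<eta>"] \<eta>
    obtain F where F: "finite F" "S - \<eta> < (\<Sum>n\<in>F. (cmod (u n))\<^sup>2)"
      by (auto simp: eventually_finite_subsets_at_top)
    \<comment> \<open>The \<open>+ 1\<close> keeps the quotient positive when \<open>F\<close> is
      empty.\<close>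
    define \<delta> where "\<delta> = sqrt (\<eta> / (card F + 1))"
    have \<delta>: "\<delta> > 0" using \<eta> by (simp add: \<delta>_def)
    have "\<exists>q\<in>Q. cmod (u n - q) < \<delta>" for n
      using dense[of "ball (u n) \<delta>"] \<delta> by (auto simp: dist_norm)
    then obtain q where q: "\<And>n. q n \<in> Q" "\<And>n. cmod (u n - q n) < \<delta>" by metis
    obtain l where l: "set l = F" using finite_list[OF F(1)] by blast
    define d where "d = g (map (\<lambda>n. (n, q n)) l)"
    have d: "d n = (if n \<in> F then q n else 0)" for n
      by (simp add: d_def g_def map_of_map_restrict l)
    have "d \<in> D" using q(1) unfolding D_def d_def by (intro imageI) auto
    have "L2_set (\<lambda>n. cmod (u n - d n)) G \<le> e / 2" if G: "finite G" for G
    proof -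
      have "(\<Sum>n\<in>G. (cmod (u n - d n))\<^sup>2) \<le> (\<Sum>n\<in>F \<union> (G - F). (cmod (u n - d n))\<^sup>2)"
        using F G by (intro sum_mono2) auto
      also have "\<dots> = (\<Sum>n\<in>F. (cmod (u n - q n))\<^sup>2) + (\<Sum>n\<in>G - F. (cmod (u n))\<^sup>2)"
        using F G by (subst sum.union_disjoint) (auto simp: d)
      also have "(\<Sum>n\<in>F. (cmod (u n - q n))\<^sup>2) \<le> (\<Sum>n\<in>F. \<delta>\<^sup>2)"
        by (intro sum_mono power_mono less_imp_le[OF q(2)]) auto
      also have "(\<Sum>n\<in>F. \<delta>\<^sup>2) \<le> \<eta>"
        using \<eta> by (simp add: \<delta>_def field_simps)
      also have "(\<Sum>n\<in>G - F. (cmod (u n))\<^sup>2) \<le> \<eta>"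
      proof -
        have "(\<Sum>n\<in>F. (cmod (u n))\<^sup>2) + (\<Sum>n\<in>G - F. (cmod (u n))\<^sup>2) =
            (\<Sum>n\<in>F \<union> (G - F). (cmod (u n))\<^sup>2)"
          using F G by (subst sum.union_disjoint) auto
        also have "\<dots> \<le> S"
          unfolding S_def using F G by (intro finite_sum_le_infsum su) auto
        finally show ?thesis using F(2) by simp
      qed
      also have "\<eta> + \<eta> = (e / 2)\<^sup>2" by (simp add: \<eta>_def power_divide)
      finally show ?thesis
        using e unfolding L2_set_def by (intro real_le_lsqrt) (auto simp: sum_nonneg)
    qed
    from ell2_normI(2)[OF this] have "ell2_norm (\<lambda>n. u n - d n) < e"
      using e by simp
    then show ?thesis using \<open>d \<in> D\<close> by blast
  qed
  ultimately show ?thesis using that[of D] fin by blast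
qed

text \<open>Both sides of the inequality are Lipschitz in the vector, with constants
  \<open>\<bar>c\<bar>\<close> and an operator bound of \<open>A - x\<close>, so the inequality
  passes from a dense set to all of \<open>ell2\<close>.\<close>

lemma bounded_below_op_dense:
  assumes A: "ell2_bounded_op A" and D: "D \<subseteq> ell2"
    and dense: "\<And>u e. u \<in> ell2 \<Longrightarrow> e > 0 \<Longrightarrow> \<exists>d\<in>D. ell2_norm (\<lambda>n. u n - d n) < e"
  shows "bounded_below_op A x c \<longleftrightarrow>
    (\<forall>d\<in>D. c * ell2_norm d \<le> ell2_norm (\<lambda>n. A d n - complex_of_real x * d n))"
proof
  assume *: "\<forall>d\<in>D. c * ell2_norm d \<le> ell2_norm (\<lambda>n. A d n - complex_of_real x * d n)"
  define B where "B = (\<lambda>u n. A u n - complex_of_real x * u n)"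
  have B: "ell2_bounded_op B" unfolding B_def by (rule ell2_bounded_op_shift[OF A])
  obtain K where K: "K > 0" "\<And>u. u \<in> ell2 \<Longrightarrow> ell2_norm (B u) \<le> K * ell2_norm u"
    using ell2_bounded_op_bound[OF B] by blast
  have "c * ell2_norm u \<le> ell2_norm (B u) + e" if u: "u \<in> ell2" and e: "e > 0" for u e
  proof -
    let ?e = "e / (K + \<bar>c\<bar>)"
    have Kc: "K + \<bar>c\<bar> > 0" using K(1) by simp
    then obtain d where d: "d \<in> D" "ell2_norm (\<lambda>n. u n - d n) < ?e"
      using dense[OF u, of ?e] e by auto
    let ?n = "ell2_norm (\<lambda>n. u n - d n)"
    have d2: "d \<in> ell2" using d D by blast
    have sym: "ell2_norm (\<lambda>n. d n - u n) = ?n"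
      by (simp add: ell2_norm_def norm_minus_commute)
    have "\<bar>ell2_norm u - ell2_norm d\<bar> \<le> ?n"
      using ell2_norm_diff_triangle[OF u d2] ell2_norm_diff_triangle[OF d2 u] sym by simp
    then have "c * (ell2_norm u - ell2_norm d) \<le> \<bar>c\<bar> * ?n"
      by (intro order_trans[OF abs_ge_self[of "c * (ell2_norm u - ell2_norm d)"]])
        (simp add: abs_mult mult_left_mono)
    then have "c * ell2_norm u \<le> ell2_norm (B d) + \<bar>c\<bar> * ?n"
      using bspec[OF * d(1)] by (simp add: B_def algebra_simps)
    also have "ell2_norm (B d) \<le> ell2_norm (B u) + K * ?n"
      using ell2_norm_diff_triangle[OF ell2_bounded_opD(1)[OF B d2] ell2_bounded_opD(1)[OF B u]]
        K(2)[OF ell2_diff(1)[OF d2 u]] by (simp add: ell2_bounded_opD(4)[OF B d2 u] sym)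
    finally have "c * ell2_norm u \<le> ell2_norm (B u) + ?n * (K + \<bar>c\<bar>)"
      by (simp add: algebra_simps)
    moreover have "?n * (K + \<bar>c\<bar>) < e"
      using d(2) Kc by (simp add: pos_less_divide_eq)
    ultimately show ?thesis by linarith
  qed
  then show "bounded_below_op A x c"
    unfolding bounded_below_op_def B_def by (blast intro: field_le_epsilon)
qed (use D in \<open>auto simp: bounded_below_op_def\<close>)

section \<open>Measurability and invariance along the orbit\<close>

lemma measurable_iterate_int:
  assumes T: "T \<in> measurable M M" and inv: "invertible_map M T"
  shows "iterate_int M T n \<in> measurable M M"
  using assms measurable_compose_n[of T M] measurable_compose_n[of "inv_into (space M) T" M]
  by (simp add: iterate_int_def invertible_map_def)

text \<open>On a finitely supported \<open>d\<close> only the support and its neighbouring sites can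
  give nonzero entries, so the norm is the root of a finite sum of measurable functions.\<close>

lemma measurable_schroedinger_norm:
  assumes T: "T \<in> measurable M M" and inv: "invertible_map M T" and f: "f \<in> borel_measurable M"
    and d: "finite {n. d n \<noteq> 0}"
  shows "(\<lambda>\<omega>. ell2_norm (\<lambda>n. schroedinger_op M T f \<omega> d n - z * d n)) \<in> borel_measurable M"
proof -
  define F where "F = (let F = {n. d n \<noteq> 0} in F \<union> (\<lambda>n. n - 1) ` F \<union> (\<lambda>n. n + 1) ` F)"
  have "finite F" using d by (simp add: F_def Let_def)
  have "d n = 0 \<and> d (n - 1) = 0 \<and> d (n + 1) = 0" if "n \<notin> F" for n
    using that by (force simp: F_def Let_def image_iff)
  then have "ell2_norm (\<lambda>n. schroedinger_op M T f \<omega> d n - z * d n) =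
      sqrt (\<Sum>\<^sub>\<infinity>n\<in>F. (cmod (schroedinger_op M T f \<omega> d n - z * d n))\<^sup>2)" for \<omega>
    unfolding ell2_norm_def by (intro arg_cong[of _ _ sqrt] infsum_cong_neutral) (auto simp: schroedinger_op_def)
  moreover have "(\<lambda>\<omega>. f (iterate_int M T n \<omega>)) \<in> borel_measurable M" for n
    using measurable_compose[OF measurable_iterate_int[OF T inv] f] .
  ultimately show ?thesis
    using \<open>finite F\<close> unfolding schroedinger_op_def by simp
qed

lemma iterate_int_shift:
  assumes "invertible_map M T" "\<omega> \<in> space M"
  shows "iterate_int M T n (T \<omega>) = iterate_int M T (n + 1) \<omega>"
proof (cases "n \<ge> 0")
  case True
  then show ?thesis
    by (simp add: iterate_int_def nat_add_distrib funpow_swap1)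
next
  case False
  then obtain m where m: "n = - int (Suc m)"
    by (metis negD not_le)
  have "inv_into (space M) T (T \<omega>) = \<omega>"
    using assms by (simp add: invertible_map_def bij_betw_def)
  then have "iterate_int M T n (T \<omega>) = (inv_into (space M) T ^^ m) \<omega>"
    by (simp add: m iterate_int_def nat_add_distrib funpow_swap1)
  also have "\<dots> = iterate_int M T (n + 1) \<omega>"
    \<comment> \<open>For \<open>m = 0\<close> the index \<open>n + 1\<close> is \<open>0\<close>
      and falls into the nonnegative branch of \<open>iterate_int\<close>, hence the case
      split.\<close>
    by (cases m) (simp_all add: m iterate_int_def nat_add_distrib)
  finally show ?thesis .
qed

text \<open>Replacing \<omega> by \<open>T \<omega>\<close> moves the potential by one site, so the
  two operators are conjugate under the index shift, an isometry of \<open>ell2\<close> onto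
  itself.\<close>

lemma bounded_below_schroedinger_invariant:
  assumes "invertible_map M T" "\<omega> \<in> space M"
  shows "bounded_below_op (schroedinger_op M T f (T \<omega>)) x c \<longleftrightarrow>
    bounded_below_op (schroedinger_op M T f \<omega>) x c"
proof -
  let ?N = "\<lambda>\<omega> u. ell2_norm (\<lambda>n. schroedinger_op M T f \<omega> u n - complex_of_real x * u n)"
  have N: "?N (T \<omega>) (\<lambda>n. u (n + 1)) = ?N \<omega> u" for u
    using ell2_norm_shift[of "\<lambda>n. schroedinger_op M T f \<omega> u n - complex_of_real x * u n" 1]
    by (simp add: schroedinger_op_def iterate_int_shift[OF assms] add.commute)
  show ?thesis
    unfolding bounded_below_op_def
  proof (intro iffI ballI)
    fix u assume u: "u \<in> ell2" and *: "\<forall>u\<in>ell2. c * ell2_norm u \<le> ?N (T \<omega>) u"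
    show "c * ell2_norm u \<le> ?N \<omega> u"
      using bspec[OF * shift_ell2(1)[OF u, of 1]] by (simp only: N ell2_norm_shift)
  next
    fix u assume u: "u \<in> ell2" and *: "\<forall>u\<in>ell2. c * ell2_norm u \<le> ?N \<omega> u"
    show "c * ell2_norm u \<le> ?N (T \<omega>) u"
      using bspec[OF * shift_ell2(1)[OF u, of "- 1"]] N[of "\<lambda>n. u (n + - 1)"]
      by (simp only: ell2_norm_shift) simp
  qed
qed

lemma measurable_bounded_below:
  assumes T: "T \<in> measurable M M" and inv: "invertible_map M T" and f: "f \<in> borel_measurable M"
    and bdd: "bounded (f ` space M)"
  shows "{\<omega> \<in> space M. bounded_below_op (schroedinger_op M T f \<omega>) x c} \<in> sets M"
proof -
  obtain D where D: "countable D" "D \<subseteq> ell2" "\<And>d. d \<in> D \<Longrightarrow> finite {n. d n \<noteq> 0}"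
    and dense: "\<And>u e. u \<in> ell2 \<Longrightarrow> e > 0 \<Longrightarrow> \<exists>d\<in>D. ell2_norm (\<lambda>n. u n - d n) < e"
    using ell2_countable_dense by blast
  have "{\<omega> \<in> space M. bounded_below_op (schroedinger_op M T f \<omega>) x c} =
      {\<omega> \<in> space M. \<forall>d\<in>D. c * ell2_norm d \<le>
        ell2_norm (\<lambda>n. schroedinger_op M T f \<omega> d n - complex_of_real x * d n)}"
    using bounded_below_op_dense[OF schroedinger_op_bounded[OF inv bdd] D(2) dense] by auto
  also have "\<dots> \<in> sets M"
    by (intro sets.sets_Collect_countable_All' borel_measurable_le
        borel_measurable_const measurable_schroedinger_norm[OF T inv f] D)
  finally show ?thesis .
qed

section \<open>Zero-one law for the lower bounds and the common spectrum\<close>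

theorem theorem4p3:
  fixes M :: "'a measure" and T :: "'a \<Rightarrow> 'a" and f :: "'a \<Rightarrow> real"
  assumes "sigma_finite_measure M"
    and "emeasure M (space M) = \<infinity>"
    and "T \<in> measurable M M"
    and "conservative_map M T"
    and "invertible_map M T"
    and "ergodic_map M T"
    and "measure_preserving_map M T"
    and "f \<in> borel_measurable M"
    and "bounded (f ` space M)"
  shows "\<exists>\<Sigma> :: real set. compact \<Sigma> \<and>
           (AE \<omega> in M. ell2_spectrum (schroedinger_op M T f \<omega>) = complex_of_real ` \<Sigma>)"
proof -
  define P where "P = (\<lambda>(q :: rat, c :: rat) \<omega>.
    bounded_below_op (schroedinger_op M T f \<omega>) (of_rat q) (of_rat c))"
  define G where "G = {p. AE \<omega> in M. P p \<omega>}"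
  \<comment> \<open>Complement of the union of the intervals \<open>(q - c, q + c)\<close> over
    \<open>G\<close>, written as an intersection of closed sets. Pairs with \<open>c \<le> 0\<close>
    all lie in \<open>G\<close> and contribute the whole line.\<close>
  define \<Sigma> :: "real set" where "\<Sigma> = (\<Inter>(q, c)\<in>G. {x. of_rat c \<le> \<bar>x - of_rat q\<bar>})"
  have zero_one: "AE \<omega> in M. P p \<omega> \<longleftrightarrow> p \<in> G" for p
  proof -
    obtain q c where p: "p = (q, c)" by (cases p)
    let ?E = "{\<omega> \<in> space M. P p \<omega>}"
    have E: "?E \<in> sets M"
      unfolding P_def p using measurable_bounded_below[OF assms(3,5,8,9)] by simp
    have "T -` ?E \<inter> space M = ?E"
      unfolding P_def p
      using bounded_below_schroedinger_invariant[OF assms(5)] measurable_space[OF assms(3)] by auto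
    then have "emeasure M ?E = 0 \<or> emeasure M (space M - ?E) = 0"
      using assms(6) E unfolding ergodic_map_def by blast
    then show ?thesis
    proof
      assume "emeasure M ?E = 0"
      then have "AE \<omega> in M. \<not> P p \<omega>"
        using E by (intro AE_I[of _ _ ?E]) auto
      \<comment> \<open>If \<open>P p\<close> held almost everywhere as well as failing almost
        everywhere, the whole space would be null, against its infinite measure.\<close>
      moreover have "p \<notin> G"
      proof
        assume "p \<in> G"
        then have "AE \<omega> in M. P p \<omega>" by (simp add: G_def)
        with calculation have "AE \<omega> in M. False" by eventually_elim blast
        then show False using assms(2) by (simp add: AE_iff_null null_sets_def)
      qed
      ultimately show ?thesis by simp
    next
      assume "emeasure M (space M - ?E) = 0"
      then have "AE \<omega> in M. P p \<omega>"
        using E by (intro AE_I[of _ _ "space M - ?E"]) auto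
      then show ?thesis by (simp add: G_def)
    qed
  qed
  have spec: "ell2_spectrum (schroedinger_op M T f \<omega>) = complex_of_real ` \<Sigma>"
    if "\<omega> \<in> space M" "\<forall>p. P p \<omega> \<longleftrightarrow> p \<in> G" for \<omega>
  proof -
    have "(\<nexists>c. c > 0 \<and> bounded_below_op (schroedinger_op M T f \<omega>) x c) \<longleftrightarrow> x \<in> \<Sigma>" for x
      using that(2)
      unfolding ex_bounded_below_op_rational[OF schroedinger_op_bounded[OF assms(5,9) that(1)]]
      by (force simp: P_def \<Sigma>_def not_less)
    then show ?thesis
      using ell2_spectrum_selfadjoint[OF schroedinger_op_selfadjoint[OF assms(5,9) that(1)]] by simp
  qed
  \<comment> \<open>Pairs of rationals are countable, so the exceptional null sets can be
    united.\<close>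
  have ae: "AE \<omega> in M. \<forall>p. P p \<omega> \<longleftrightarrow> p \<in> G"
    using zero_one by (simp add: AE_all_countable)
  \<comment> \<open>A single typical point exists because the space is not null; its operator bound
    then bounds \<Sigma>.\<close>
  obtain \<omega> where \<omega>: "\<omega> \<in> space M" "\<forall>p. P p \<omega> \<longleftrightarrow> p \<in> G"
  proof (rule ccontr)
    assume "\<not> thesis"
    with that have *: "\<not> (\<forall>p. P p \<omega> \<longleftrightarrow> p \<in> G)" if "\<omega> \<in> space M" for \<omega>
      using that by blast
    have "AE \<omega> in M. False"
      using ae AE_space[of M] by eventually_elim (use * in blast)
    then show False using assms(2) by (simp add: AE_iff_null null_sets_def)
  qed
  have "bounded \<Sigma>"
  proof -
    note A = schroedinger_op_bounded[OF assms(5,9) \<omega>(1)]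
    obtain K where K: "\<And>x. \<bar>x\<bar> > K \<Longrightarrow> \<exists>c>0. bounded_below_op (schroedinger_op M T f \<omega>) x c"
      using bounded_below_op_large[OF A] by blast
    have "\<bar>x\<bar> \<le> K" if "x \<in> \<Sigma>" for x
    proof (rule ccontr)
      assume "\<not> \<bar>x\<bar> \<le> K"
      then have "\<exists>c>0. bounded_below_op (schroedinger_op M T f \<omega>) x c"
        using K by simp
      moreover have "complex_of_real x \<in> ell2_spectrum (schroedinger_op M T f \<omega>)"
        using that spec[OF \<omega>] by simp
      ultimately show False
        unfolding ell2_spectrum_selfadjoint[OF schroedinger_op_selfadjoint[OF assms(5,9) \<omega>(1)]]
        by auto
    qed
    then show ?thesis by (auto simp: bounded_iff)
  qed
  moreover have "closed \<Sigma>"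
    unfolding \<Sigma>_def by (intro closed_INT ballI) (auto intro!: closed_Collect_le continuous_intros)
  moreover have "AE \<omega> in M. ell2_spectrum (schroedinger_op M T f \<omega>) = complex_of_real ` \<Sigma>"
    using ae AE_space[of M] by eventually_elim (rule spec)
  ultimately show ?thesis
    by (auto simp: compact_eq_bounded_closed)
qed

end
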